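(* Assume that the map $h\mapsto F''(\bar x)h^2$ is sequentially weak-$\star$ lower semicontinuous on $X$ and that at least one of the following two conditions is satisfied: (a) the map $h\mapsto F''(\bar x)h^2$ is sequentially weak-$\star$ upper semicontinuous; (b) $G$ is strongly twice epi-differentiable at $\bar x$ for $-F'(\bar x)$. Then the two conditions $$F''(\bar x)h^2+G''(\bar x,-F'(\bar x);h)>0\qquad\forall h\in X\setminus\{0\}$$ and (NDC) both hold if and only if there exist constants $c>0$ and $\varepsilon>0$ such that the quadratic growth condition $$\Phi(x)\ge\Phi(\bar x)+\frac c2\|x-\bar x\|_X^2\qquad\forall x\in X,\ \|x-\bar x\|_X\le\varepsilon$$ is satisfied.
   Context: Setting: $X$ is the (topological) dual space of a separable real Banach space $Y$. $G\colon X\to(-\infty,\infty]$ is a function with domain $\operatorname{dom}(G)=\{x: G(x)<\infty\}$, and $F\colon\operatorname{dom}(G)\to\mathbb R$. Put $\Phi:=F+G$ (with $\Phi=+\infty$ outside $\operatorname{dom}(G)$). The point $\bar x\in\operatorname{dom}(G)$ is fixed. There exist $F'(\bar x)\in Y$ and a bounded bilinear form $F''(\bar x)\colon X\times X\to\mathbb R$ with $$\lim_{k\to\infty}\frac{F(\bar x+t_kh_k)-F(\bar x)-t_kF'(\bar x)h_k-\frac12t_k^2F''(\bar x)h_k^2}{t_k^2}=0$$ for all sequences $(t_k)\subset(0,\infty)$, $(h_k)\subset X$ with $t_k\searrow0$, $h_k\stackrel{\star}{\rightharpoonup}h\in X$ and $\bar x+t_kh_k\in\operatorname{dom}(G)$.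 Here $F'(\bar x)h:=\langle F'(\bar x),h\rangle$ and $F''(\bar x)h^2:=F''(\bar x)(h,h)$. Weak-$\star$ second subderivative: for $x\in\operatorname{dom}(G)$, $w\in Y$, $h\in X$, $$G''(x,w;h):=\inf\Big\{\liminf_{k\to\infty}\frac{G(x+t_kh_k)-G(x)-t_k\langle w,h_k\rangle}{t_k^2/2}\ :\ t_k\searrow0,\ h_k\stackrel\star\rightharpoonup h\Big\}\in[-\infty,\infty].$$ $G$ is strongly twice epi-differentiable at $x$ for $w$ if for every $h\in X$ and every $(t_k)\subset(0,\infty)$ with $t_k\searrow0$ there is $(h_k)\subset X$ with $h_k\to h$ in norm and $G''(x,w;h)=\lim_{k\to\infty}\frac{G(x+t_kh_k)-G(x)-t_k\langle w,h_k\rangle}{t_k^2/2}$. (NDC) denotes the condition: for all $(t_k)\subset(0,\infty)$, $(h_k)\subset X$ with $t_k\searrow0$, $h_k\stackrel\star\rightharpoonup0$ and $\|h_k\|_X=1$, $$\liminf_{k\to\infty}\Big(\frac1{t_k^2}\big(G(\bar x+t_kh_k)-G(\bar x)\big)+\langle F'(\bar x),h_k/t_k\rangle+\frac12F''(\bar x)h_k^2\Big)>0.$$ *)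

theory Defs
  imports "HOL-Analysis.Analysis"
begin

text \<open>
  The dual of a real Banach space with carrier type \<open>'y\<close> is \<open>'y \<Rightarrow>\<^sub>L real\<close>,
  normed by the operator norm.  For functionals, the library's strong operator topology
  (pointwise convergence) is the weak-star topology.
\<close>

type_synonym 'y dual = "'y \<Rightarrow>\<^sub>L real"

definition weak_star_tendsto ::
  "(nat \<Rightarrow> 'y::real_normed_vector dual) \<Rightarrow> 'y dual \<Rightarrow> bool" where
  "weak_star_tendsto hs h \<longleftrightarrow> limitin strong_operator_topology hs h sequentially"

lemma weak_star_tendsto_iff:
  "weak_star_tendsto hs h \<longleftrightarrow>
     (\<forall>y. (\<lambda>k. blinfun_apply (hs k) y) \<longlonglongrightarrow> blinfun_apply h y)"
proof
  assume L: "weak_star_tendsto hs h"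
  show "\<forall>y. (\<lambda>k. blinfun_apply (hs k) y) \<longlonglongrightarrow> blinfun_apply h y"
  proof
    fix y
    have "limitin euclidean ((\<lambda>f. blinfun_apply f y) \<circ> hs) (blinfun_apply h y) sequentially"
      using L strong_operator_topology_continuous_evaluation
      unfolding weak_star_tendsto_def by (rule continuous_map_limit[rotated])
    then show "(\<lambda>k. blinfun_apply (hs k) y) \<longlonglongrightarrow> blinfun_apply h y"
      by (simp add: o_def)
  qed
next
  assume R: "\<forall>y. (\<lambda>k. blinfun_apply (hs k) y) \<longlonglongrightarrow> blinfun_apply h y"
  then have "limitin (product_topology (\<lambda>_. euclidean) UNIV)
      (\<lambda>k. blinfun_apply (hs k)) (blinfun_apply h) sequentially"
    by (simp add: limitin_componentwise)
  then have prod: "limitin euclidean (\<lambda>k. blinfun_apply (hs k)) (blinfun_apply h) sequentially"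
    by (simp add: euclidean_product_topology)
  show "weak_star_tendsto hs h"
    unfolding weak_star_tendsto_def limitin_def
  proof (intro conjI allI impI)
    show "h \<in> topspace strong_operator_topology"
      by (simp add: strong_operator_topology_topspace)
    fix U assume "openin strong_operator_topology U \<and> h \<in> U"
    then obtain V where "open V" "U = blinfun_apply -` V" "h \<in> U"
      unfolding strong_operator_topology_def openin_pullback_topology by auto
    with prod show "\<forall>\<^sub>F k in sequentially. hs k \<in> U"
      by (auto simp: limitin_def)
  qed
qed

text \<open>The sequences written \<open>t\<^sub>k \<searrow> 0\<close>: positive and convergent to zero
  (monotonicity is not required).\<close>

definition pos_null_seq :: "(nat \<Rightarrow> real) \<Rightarrow> bool" where
  "pos_null_seq t \<longleftrightarrow> (\<forall>k. 0 < t k) \<and> t \<longlonglongrightarrow> 0"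

definition seq_weak_star_lsc :: "('y::real_normed_vector dual \<Rightarrow> real) \<Rightarrow> bool" where
  "seq_weak_star_lsc q \<longleftrightarrow>
     (\<forall>hs h. weak_star_tendsto hs h \<longrightarrow> ereal (q h) \<le> liminf (\<lambda>k. ereal (q (hs k))))"

definition seq_weak_star_usc :: "('y::real_normed_vector dual \<Rightarrow> real) \<Rightarrow> bool" where
  "seq_weak_star_usc q \<longleftrightarrow>
     (\<forall>hs h. weak_star_tendsto hs h \<longrightarrow> limsup (\<lambda>k. ereal (q (hs k))) \<le> ereal (q h))"

definition eff_dom :: "('x \<Rightarrow> ereal) \<Rightarrow> 'x set" where
  "eff_dom G = {x. G x < \<infinity>}"

text \<open>A function on \<open>dom G\<close> is represented by a total function \<open>F\<close>;
  its values outside \<open>eff_dom G\<close> are never used.\<close>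

definition objective :: "('x \<Rightarrow> real) \<Rightarrow> ('x \<Rightarrow> ereal) \<Rightarrow> 'x \<Rightarrow> ereal" where
  "objective F G x = (if x \<in> eff_dom G then ereal (F x) + G x else \<infinity>)"

definition second_order_expansion ::
  "('y::real_normed_vector dual \<Rightarrow> ereal) \<Rightarrow> ('y dual \<Rightarrow> real) \<Rightarrow> 'y dual \<Rightarrow>
     'y \<Rightarrow> ('y dual \<Rightarrow> 'y dual \<Rightarrow> real) \<Rightarrow> bool" where
  "second_order_expansion G F x F1 F2 \<longleftrightarrow>
     (\<forall>t hs h. pos_null_seq t \<and> weak_star_tendsto hs h \<and>
        (\<forall>k. x + t k *\<^sub>R hs k \<in> eff_dom G) \<longrightarrow>
        (\<lambda>k. (F (x + t k *\<^sub>R hs k) - F x - t k * blinfun_apply (hs k) F1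
               - 1 / 2 * (t k)\<^sup>2 * F2 (hs k) (hs k)) / (t k)\<^sup>2) \<longlonglongrightarrow> 0)"

definition second_diff_quot ::
  "('y::real_normed_vector dual \<Rightarrow> ereal) \<Rightarrow> 'y dual \<Rightarrow> 'y \<Rightarrow> real \<Rightarrow> 'y dual \<Rightarrow> ereal" where
  "second_diff_quot G x w t h =
     (G (x + t *\<^sub>R h) - G x - ereal (t * blinfun_apply h w)) / ereal (t\<^sup>2 / 2)"

definition weak_star_second_subderiv ::
  "('y::real_normed_vector dual \<Rightarrow> ereal) \<Rightarrow> 'y dual \<Rightarrow> 'y \<Rightarrow> 'y dual \<Rightarrow> ereal" where
  "weak_star_second_subderiv G x w h =
     Inf {liminf (\<lambda>k. second_diff_quot G x w (t k) (hs k)) | t hs.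
            pos_null_seq t \<and> weak_star_tendsto hs h}"

definition strongly_twice_epi_diff ::
  "('y::real_normed_vector dual \<Rightarrow> ereal) \<Rightarrow> 'y dual \<Rightarrow> 'y \<Rightarrow> bool" where
  "strongly_twice_epi_diff G x w \<longleftrightarrow>
     (\<forall>h t. pos_null_seq t \<longrightarrow>
        (\<exists>hs. hs \<longlonglongrightarrow> h \<and>
           (\<lambda>k. second_diff_quot G x w (t k) (hs k))
              \<longlonglongrightarrow> weak_star_second_subderiv G x w h))"

definition NDC ::
  "('y::real_normed_vector dual \<Rightarrow> ereal) \<Rightarrow> 'y dual \<Rightarrow> 'y \<Rightarrow>
     ('y dual \<Rightarrow> 'y dual \<Rightarrow> real) \<Rightarrow> bool" where
  "NDC G x F1 F2 \<longleftrightarrow>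
     (\<forall>t hs. pos_null_seq t \<and> weak_star_tendsto hs 0 \<and> (\<forall>k. norm (hs k) = 1) \<longrightarrow>
        0 < liminf (\<lambda>k. ereal (1 / (t k)\<^sup>2) * (G (x + t k *\<^sub>R hs k) - G x)
                        + ereal (blinfun_apply (hs k /\<^sub>R t k) F1)
                        + ereal (1 / 2 * F2 (hs k) (hs k))))"

definition quadratic_growth ::
  "('x::real_normed_vector \<Rightarrow> ereal) \<Rightarrow> 'x \<Rightarrow> real \<Rightarrow> real \<Rightarrow> bool" where
  "quadratic_growth \<Phi> x0 c \<epsilon> \<longleftrightarrow>
     (\<forall>x. norm (x - x0) \<le> \<epsilon> \<longrightarrow> \<Phi> x \<ge> \<Phi> x0 + ereal (c / 2 * (norm (x - x0))\<^sup>2))"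

end

theory Submission
  imports Defs "HOL-Complex_Analysis.Great_Picard"
begin

text \<open>
  For \<open>x + t h\<close> in \<open>dom G\<close> the growth inequality at \<open>x + t h\<close> with constant \<open>c\<close> says exactly that
  the second-order difference quotient of \<open>G\<close> is at least \<open>c \<parallel>h\<parallel>\<^sup>2 - F''(h, h)\<close>, up to the
  remainder of the expansion of \<open>F\<close>, which vanishes along weak-star convergent directions.
  Taking lower limits gives both second-order conditions; (a) or (b) controls the upper limit of
  \<open>F''\<close> along the directions, in case (b) because norm convergent directions suffice.
  Conversely, if growth fails, normalise a violating sequence and extract a weak-star convergent
  subsequence of directions: a zero limit contradicts (NDC), a nonzero limit contradicts
  positivity, by lower semicontinuity of \<open>F''\<close>.
\<close>

section \<open>Weak-star sequential convergence\<close>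

lemma weak_star_tendsto_subseq:
  assumes "weak_star_tendsto hs h" "strict_mono (r :: nat \<Rightarrow> nat)"
  shows "weak_star_tendsto (hs \<circ> r) h"
  using assms LIMSEQ_subseq_LIMSEQ[OF _ assms(2)]
  by (auto simp: weak_star_tendsto_iff o_def)

lemma tendsto_imp_weak_star_tendsto:
  assumes "hs \<longlonglongrightarrow> h"
  shows "weak_star_tendsto hs h"
  unfolding weak_star_tendsto_iff by (intro allI blinfun.tendsto assms tendsto_const)

lemma pos_null_seq_subseq:
  assumes "pos_null_seq t" "strict_mono (r :: nat \<Rightarrow> nat)"
  shows "pos_null_seq (t \<circ> r)"
  using assms LIMSEQ_subseq_LIMSEQ[of t 0 r] by (auto simp: pos_null_seq_def)

text \<open>Uniform boundedness principle by Baire. If every open set \<open>T n\<close>, where some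
  \<open>hs k\<close> exceeds \<open>n\<close> in norm, were dense, then all of them would share a
  point of the complete space, and the sequence would be unbounded there. Hence some
  \<open>T n\<close> misses a ball.\<close>

lemma pointwise_bounded_imp_norm_bounded:
  fixes hs :: "nat \<Rightarrow> 'a::banach \<Rightarrow>\<^sub>L 'b::real_normed_vector"
  assumes pointwise: "\<And>y. bounded (range (\<lambda>k. blinfun_apply (hs k) y))"
  shows "bounded (range hs)"
proof -
  define T where "T n = (\<Union>k. {y. real n < norm (blinfun_apply (hs k) y)})" for n :: nat
  have open_T: "open (T n)" for n
    unfolding T_def by (intro open_UN ballI open_Collect_less continuous_intros)
  have "\<exists>n. closure (T n) \<noteq> UNIV"
  proof (rule ccontr)
    assume "\<nexists>n. closure (T n) \<noteq> UNIV"
    then have dense: "closure (T n) = UNIV" for n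
      by blast
    have "euclidean closure_of \<Inter>(range T) = topspace (euclidean :: 'a topology)"
      by (rule Baire_category)
         (use open_T dense in \<open>auto simp: completely_metrizable_space_euclidean\<close>)
    then have "\<Inter>(range T) \<noteq> {}"
      by auto
    then obtain y where y: "\<And>n. y \<in> T n"
      by blast
    obtain B where B: "\<And>k. norm (blinfun_apply (hs k) y) \<le> B"
      using pointwise[of y] by (auto simp: bounded_iff)
    obtain n :: nat where "B < real n"
      using reals_Archimedean2 by blast
    then show False
      using y[of n] B unfolding T_def by (meson UN_E less_trans mem_Collect_eq not_less)
  qed
  then obtain n a where a: "a \<in> - closure (T n)"
    by blast
  obtain r where r: "0 < r" "cball a r \<subseteq> - closure (T n)"
    using open_contains_cball[of "- closure (T n)"] a by blast
  have on_ball: "norm (blinfun_apply (hs k) y) \<le> real n" if "norm (y - a) \<le> r" for k y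
  proof -
    have "y \<in> cball a r"
      using that by (simp add: dist_norm norm_minus_commute)
    then have "y \<notin> T n"
      using r closure_subset by blast
    then show ?thesis
      by (auto simp: T_def not_less)
  qed
  have "norm (hs k) \<le> 2 * real n / r" for k
  proof (rule norm_blinfun_bound)
    fix y
    show "norm (blinfun_apply (hs k) y) \<le> 2 * real n / r * norm y"
    proof (cases "y = 0")
      case False
      \<comment> \<open>\<open>z\<close> is \<open>y\<close> rescaled to norm \<open>r\<close>, so
        \<open>a\<close> and \<open>a + z\<close> both lie in the ball where the bound
        \<open>n\<close> holds; their difference costs \<open>2 * n\<close>.\<close>
      define z where "z = (r / norm y) *\<^sub>R y"
      have "norm (blinfun_apply (hs k) z) = norm (blinfun_apply (hs k) (a + z) - blinfun_apply (hs k) a)"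
        by (simp add: blinfun.add_right)
      also have "\<dots> \<le> real n + real n"
        by (rule order_trans[OF norm_triangle_ineq4 add_mono[OF on_ball on_ball]])
           (use r False in \<open>auto simp: z_def\<close>)
      finally have "r / norm y * norm (blinfun_apply (hs k) y) \<le> 2 * real n"
        using r by (simp add: z_def blinfun.scaleR_right)
      then show ?thesis
        using r False by (simp add: field_simps)
    qed simp
  qed (use r in auto)
  then show ?thesis
    by (auto simp: bounded_iff)
qed

lemma weak_star_tendsto_imp_bounded:
  fixes hs :: "nat \<Rightarrow> 'y::banach dual"
  assumes "weak_star_tendsto hs h"
  shows "bounded (range hs)"
  using assms
  by (intro pointwise_bounded_imp_norm_bounded)
     (auto simp: weak_star_tendsto_iff intro: convergent_imp_bounded)

text \<open>The dual norm is a supremum of evaluations, each of which is weak-star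
  continuous.\<close>

lemma weak_star_norm_lsc:
  assumes "weak_star_tendsto hs h" "a < norm h"
  shows "\<forall>\<^sub>F k in sequentially. a < norm (hs k)"
proof (cases "a < 0")
  case True
  then show ?thesis
    by (intro always_eventually allI) (use norm_ge_zero in \<open>blast intro: order.strict_trans2\<close>)
next
  case False
  \<comment> \<open>Otherwise the nonnegative number \<open>a\<close> would bound the operator norm
    of \<open>h\<close>.\<close>
  then obtain y where y: "a * norm y < norm (blinfun_apply h y)"
    using norm_blinfun_bound[of a h] assms(2) by (meson not_less)
  have "(\<lambda>k. norm (blinfun_apply (hs k) y)) \<longlonglongrightarrow> norm (blinfun_apply h y)"
    using assms(1) by (intro tendsto_norm) (auto simp: weak_star_tendsto_iff)
  then have "\<forall>\<^sub>F k in sequentially. a * norm y < norm (blinfun_apply (hs k) y)"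
    using y by (rule order_tendstoD)
  then show ?thesis
  proof eventually_elim
    case (elim k)
    then have "a * norm y < norm (hs k) * norm y"
      using norm_blinfun[of "hs k" y] by linarith
    then show ?case
      by (simp add: mult_less_cancel_right)
  qed
qed

text \<open>Sequential Banach-Alaoglu: a diagonal subsequence converges on a countable dense set,
  the uniform norm bound carries the Cauchy property to every point, and the pointwise limit is
  again a bounded functional.\<close>

lemma separable_bounded_weak_star_convergent_subseq:
  fixes hs :: "nat \<Rightarrow> 'y::real_normed_vector dual"
  assumes sep: "separable_space (euclidean :: 'y topology)"
    and bound: "\<And>k. norm (hs k) \<le> B"
  obtains r h where "strict_mono (r :: nat \<Rightarrow> nat)" "weak_star_tendsto (hs \<circ> r) h"
proof -
  obtain S :: "'y set" where S: "countable S" "closure S = UNIV"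
    using sep by (auto simp: separable_space_def)
  have B: "0 \<le> B"
    using bound[of 0] norm_ge_zero order_trans by blast
  \<comment> \<open>Normalising the points of \<open>S\<close> makes the bound uniform in the point, as the
    diagonal argument in the library requires.\<close>
  have "norm (blinfun_apply (hs n) (sgn y)) \<le> B" for n y
    using norm_blinfun[of "hs n" "sgn y"] bound[of n] B by (auto simp: norm_sgn split: if_splits)
  then obtain r :: "nat \<Rightarrow> nat" where r: "strict_mono r"
    and conv_sgn: "\<And>y. y \<in> S \<Longrightarrow> \<exists>l. (\<lambda>n. blinfun_apply (hs (r n)) (sgn y)) \<longlonglongrightarrow> l"
    using function_convergent_subsequence[OF S(1), of "\<lambda>n y. blinfun_apply (hs n) (sgn y)" B]
    by (metis real_norm_def)
  have conv_S: "Cauchy (\<lambda>n. blinfun_apply (hs (r n)) y)" if y: "y \<in> S" for y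
  proof -
    obtain l where "(\<lambda>n. blinfun_apply (hs (r n)) (sgn y)) \<longlonglongrightarrow> l"
      using conv_sgn[OF y] by blast
    then have "(\<lambda>n. norm y * blinfun_apply (hs (r n)) (sgn y)) \<longlonglongrightarrow> norm y * l"
      by (intro tendsto_intros)
    moreover have "norm y * blinfun_apply f (sgn y) = blinfun_apply f y" for f :: "'y dual"
      by (cases "y = 0") (simp_all add: sgn_div_norm blinfun.scaleR_right)
    ultimately show ?thesis
      by (simp add: LIMSEQ_imp_Cauchy)
  qed
  have cauchy: "Cauchy (\<lambda>n. blinfun_apply (hs (r n)) y)" for y
  proof (rule metric_CauchyI)
    fix e :: real
    assume "0 < e"
    \<comment> \<open>Replacing \<open>y\<close> by a point of \<open>S\<close> within
      \<open>d\<close> changes each value by less than \<open>e / 3\<close>; \<open>B + 1\<close>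
      avoids division by zero when \<open>B = 0\<close>.\<close>
    define d where "d = e / (3 * (B + 1))"
    have "0 < d"
      using \<open>0 < e\<close> B by (simp add: d_def)
    moreover have "y \<in> closure S"
      using S by simp
    ultimately obtain s where s: "s \<in> S" "dist s y < d"
      unfolding closure_approachable by blast
    have near: "\<bar>blinfun_apply (hs k) y - blinfun_apply (hs k) s\<bar> < e / 3" for k
    proof -
      have "\<bar>blinfun_apply (hs k) y - blinfun_apply (hs k) s\<bar> \<le> norm (hs k) * norm (y - s)"
        using norm_blinfun[of "hs k" "y - s"] by (simp add: blinfun.diff_right)
      also have "\<dots> \<le> B * norm (y - s)"
        by (intro mult_right_mono bound) simp
      also have "\<dots> \<le> B * d"
        using s B by (intro mult_left_mono) (auto simp: dist_norm norm_minus_commute)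
      also have "\<dots> < (B + 1) * d"
        using \<open>0 < d\<close> by simp
      also have "\<dots> = e / 3"
        using B by (simp add: d_def field_simps)
      finally show ?thesis .
    qed
    obtain M where M: "\<And>m n. m \<ge> M \<Longrightarrow> n \<ge> M \<Longrightarrow>
        dist (blinfun_apply (hs (r m)) s) (blinfun_apply (hs (r n)) s) < e / 3"
      using metric_CauchyD[OF conv_S[OF s(1)], of "e / 3"] \<open>0 < e\<close> by auto
    show "\<exists>M. \<forall>m\<ge>M. \<forall>n\<ge>M. dist (blinfun_apply (hs (r m)) y) (blinfun_apply (hs (r n)) y) < e"
    proof (intro exI[of _ M] allI impI)
      fix m n
      assume "M \<le> m" "M \<le> n"
      then show "dist (blinfun_apply (hs (r m)) y) (blinfun_apply (hs (r n)) y) < e"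
        using M[of m n] near[of "r m"] near[of "r n"] unfolding dist_real_def by linarith
    qed
  qed
  define f where "f y = lim (\<lambda>n. blinfun_apply (hs (r n)) y)" for y
  have f: "(\<lambda>n. blinfun_apply (hs (r n)) y) \<longlonglongrightarrow> f y" for y
    using cauchy[of y] unfolding f_def by (simp add: Cauchy_convergent_iff convergent_LIMSEQ_iff)
  have "bounded_linear f"
  proof (rule bounded_linear_intro)
    show "f (x + y) = f x + f y" for x y
      using tendsto_add[OF f[of x] f[of y]] f[of "x + y"]
      by (simp add: blinfun.add_right LIMSEQ_unique)
    show "f (c *\<^sub>R x) = c *\<^sub>R f x" for c x
      using tendsto_scaleR[OF tendsto_const[of c] f[of x]] f[of "c *\<^sub>R x"]
      by (simp add: blinfun.scaleR_right LIMSEQ_unique)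
    show "norm (f x) \<le> norm x * B" for x
    proof (rule tendsto_upperbound[OF tendsto_norm[OF f[of x]]])
      have "norm (blinfun_apply (hs (r n)) x) \<le> norm x * B" for n
        using order_trans[OF norm_blinfun[of "hs (r n)" x]] mult_right_mono[OF bound, of "norm x"]
        by (simp add: mult.commute)
      then show "\<forall>\<^sub>F n in sequentially. norm (blinfun_apply (hs (r n)) x) \<le> norm x * B"
        by simp
    qed simp
  qed
  then have "weak_star_tendsto (hs \<circ> r) (Blinfun f)"
    using f by (simp add: weak_star_tendsto_iff bounded_linear_Blinfun_apply)
  then show ?thesis
    using that r by blast
qed

section \<open>Second-order difference quotients\<close>

text \<open>The quantity that \<open>second_order_expansion\<close> sends to zero, already divided
  by \<open>t^2\<close>; it enters second-order quotients with a factor 2.\<close>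

definition expansion_remainder ::
  "('y::real_normed_vector dual \<Rightarrow> real) \<Rightarrow> 'y dual \<Rightarrow> 'y \<Rightarrow> ('y dual \<Rightarrow> 'y dual \<Rightarrow> real) \<Rightarrow>
     real \<Rightarrow> 'y dual \<Rightarrow> real" where
  "expansion_remainder F x F1 F2 t h =
     (F (x + t *\<^sub>R h) - F x - t * blinfun_apply h F1 - 1 / 2 * t\<^sup>2 * F2 h h) / t\<^sup>2"

text \<open>The expansion hypothesis covers only sequences staying in the domain throughout, whereas
  here some points may leave it. If the claim failed, the infinitely many bad indices would form a
  subsequence inside the domain whose remainder does not vanish.\<close>

lemma eventually_expansion_remainder_small:
  assumes exp: "second_order_expansion G F x F1 F2"
    and t: "pos_null_seq t" and hs: "weak_star_tendsto hs h" and e: "0 < e"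
  shows "\<forall>\<^sub>F k in sequentially. x + t k *\<^sub>R hs k \<in> eff_dom G \<longrightarrow>
           \<bar>expansion_remainder F x F1 F2 (t k) (hs k)\<bar> < e"
proof (rule ccontr)
  define P where "P k \<longleftrightarrow> x + t k *\<^sub>R hs k \<in> eff_dom G \<and>
    \<not> \<bar>expansion_remainder F x F1 F2 (t k) (hs k)\<bar> < e" for k
  assume "\<not> ?thesis"
  then have "\<exists>\<^sub>\<infinity>k. P k"
    by (simp add: frequently_def P_def cofinite_eq_sequentially)
  then have "infinite {k. P k}"
    by (simp add: frequently_cofinite)
  then obtain r :: "nat \<Rightarrow> nat" where r: "strict_mono r" "\<And>n. P (r n)"
    using infinite_enumerate by blast
  have "(\<lambda>k. expansion_remainder F x F1 F2 ((t \<circ> r) k) ((hs \<circ> r) k)) \<longlonglongrightarrow> 0"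
    using exp[unfolded second_order_expansion_def, rule_format, of "t \<circ> r" "hs \<circ> r" h]
      pos_null_seq_subseq[OF t r(1)] weak_star_tendsto_subseq[OF hs r(1)] r(2)
    by (simp add: expansion_remainder_def P_def)
  then have "\<forall>\<^sub>F k in sequentially. \<bar>expansion_remainder F x F1 F2 ((t \<circ> r) k) ((hs \<circ> r) k)\<bar> < e"
    using e by (auto simp: tendsto_iff)
  then show False
    using r(2) by (auto simp: P_def dest: eventually_happens)
qed

lemma second_diff_quot_outside:
  assumes "G x \<noteq> -\<infinity>" "x \<in> eff_dom G" "0 < t" "x + t *\<^sub>R h \<notin> eff_dom G"
  shows "second_diff_quot G x w t h = \<infinity>"
proof -
  obtain g where "G x = ereal g"
    using assms by (cases "G x") (auto simp: eff_dom_def)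
  moreover have "G (x + t *\<^sub>R h) = \<infinity>"
    using assms by (simp add: eff_dom_def)
  ultimately show ?thesis
    using assms by (simp add: second_diff_quot_def)
qed

text \<open>Substitute the expansion of \<open>F\<close> and divide by \<open>t^2 / 2\<close>. The
  constant \<open>a\<close> is free: it becomes \<open>c * (norm h)^2\<close> for a given growth
  constant, and the vanishing constant of a violated growth inequality along unit
  directions.\<close>

lemma growth_iff_second_diff_quot:
  assumes "\<And>x. G x \<noteq> -\<infinity>" "x \<in> eff_dom G" "x + t *\<^sub>R h \<in> eff_dom G" "0 < t"
  shows "objective F G x + ereal (a / 2 * t\<^sup>2) \<le> objective F G (x + t *\<^sub>R h) \<longleftrightarrow>
    ereal (a - F2 h h - 2 * expansion_remainder F x F1 F2 t h) \<le> second_diff_quot G x (- F1) t h"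
proof -
  obtain g g' where g: "G x = ereal g" "G (x + t *\<^sub>R h) = ereal g'"
    using assms by (cases "G x"; cases "G (x + t *\<^sub>R h)") (auto simp: eff_dom_def)
  define R where "R = expansion_remainder F x F1 F2 t h"
  have expansion: "F (x + t *\<^sub>R h) = F x + t * blinfun_apply h F1 + t\<^sup>2 * (F2 h h / 2 + R)"
    using assms(4) unfolding R_def expansion_remainder_def by (simp add: field_simps)
  have "a - F2 h h - 2 * R \<le> (g' - g + t * blinfun_apply h F1) / (t\<^sup>2 / 2) \<longleftrightarrow>
    (a - F2 h h - 2 * R) * (t\<^sup>2 / 2) \<le> g' - g + t * blinfun_apply h F1"
    using assms(4) by (intro pos_le_divide_eq) simp
  also have "\<dots> \<longleftrightarrow> F x + g + a / 2 * t\<^sup>2 \<le> F (x + t *\<^sub>R h) + g'"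
    using assms(4) unfolding expansion by (simp add: algebra_simps add_divide_distrib)
  finally show ?thesis
    using assms g by (simp add: objective_def second_diff_quot_def blinfun.minus_right R_def)
qed

text \<open>Lets (NDC) be handled through the same quotient as the subderivative; the factor
  \<open>1 / 2\<close> reflects the normalisations \<open>t^2\<close> and
  \<open>t^2 / 2\<close>.\<close>

lemma NDC_quotient_eq:
  assumes "G x \<noteq> -\<infinity>" "x \<in> eff_dom G" "G (x + t *\<^sub>R h) \<noteq> -\<infinity>" "0 < t"
  shows "ereal (1 / t\<^sup>2) * (G (x + t *\<^sub>R h) - G x) + ereal (blinfun_apply (h /\<^sub>R t) F1)
           + ereal (1 / 2 * F2 h h)
         = ereal (1 / 2) * (second_diff_quot G x (- F1) t h + ereal (F2 h h))"
proof -
  obtain g where g: "G x = ereal g"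
    using assms by (cases "G x") (auto simp: eff_dom_def)
  show ?thesis
  proof (cases "G (x + t *\<^sub>R h)")
    case (real g')
    then show ?thesis
      using assms g
      by (simp add: second_diff_quot_def blinfun.scaleR_left blinfun.minus_right field_simps
          power2_eq_square)
  qed (use assms g in \<open>auto simp: second_diff_quot_def\<close>)
qed

text \<open>Common source of both necessary conditions. Weak-star convergent directions are bounded,
  so the points \<open>x + t k *\<^sub>R hs k\<close> eventually enter the growth ball. Points
  outside the domain have an infinite quotient, and inside it the doubled remainder costs at most
  \<open>e\<close>.\<close>

lemma quadratic_growth_imp_second_diff_quot_ge:
  fixes G :: "'y::banach dual \<Rightarrow> ereal"
  assumes G: "\<And>x. G x \<noteq> -\<infinity>" and x: "x \<in> eff_dom G"
    and exp: "second_order_expansion G F x F1 F2"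
    and growth: "quadratic_growth (objective F G) x c \<epsilon>" and "0 < \<epsilon>"
    and t: "pos_null_seq t" and hs: "weak_star_tendsto hs h" and e: "0 < e"
  shows "\<forall>\<^sub>F k in sequentially. ereal (c * (norm (hs k))\<^sup>2 - F2 (hs k) (hs k) - e)
           \<le> second_diff_quot G x (- F1) (t k) (hs k)"
proof -
  have t_pos: "0 < t k" for k
    using t by (simp add: pos_null_seq_def)
  obtain B where B: "\<And>k. norm (hs k) \<le> B"
    using weak_star_tendsto_imp_bounded[OF hs] by (auto simp: bounded_iff)
  have "(\<lambda>k. t k * B) \<longlonglongrightarrow> 0"
    using t by (auto simp: pos_null_seq_def intro: tendsto_mult_left_zero)
  then have "\<forall>\<^sub>F k in sequentially. t k * B < \<epsilon>"
    using \<open>0 < \<epsilon>\<close> by (rule order_tendstoD)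
  moreover have "\<forall>\<^sub>F k in sequentially. x + t k *\<^sub>R hs k \<in> eff_dom G \<longrightarrow>
      \<bar>expansion_remainder F x F1 F2 (t k) (hs k)\<bar> < e / 2"
    using e by (intro eventually_expansion_remainder_small[OF exp t hs]) simp
  ultimately show ?thesis
  proof eventually_elim
    case (elim k)
    show ?case
    proof (cases "x + t k *\<^sub>R hs k \<in> eff_dom G")
      case True
      have "t k * norm (hs k) \<le> \<epsilon>"
        using mult_left_mono[OF B[of k], of "t k"] t_pos[of k] elim by linarith
      then have "norm (x + t k *\<^sub>R hs k - x) \<le> \<epsilon>"
        using t_pos[of k] by simp
      then have "objective F G x + ereal (c / 2 * (norm (x + t k *\<^sub>R hs k - x))\<^sup>2)
          \<le> objective F G (x + t k *\<^sub>R hs k)"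
        using growth unfolding quadratic_growth_def by blast
      then have "objective F G x + ereal (c * (norm (hs k))\<^sup>2 / 2 * (t k)\<^sup>2)
          \<le> objective F G (x + t k *\<^sub>R hs k)"
        by (simp add: power_mult_distrib mult_ac)
      then have "ereal (c * (norm (hs k))\<^sup>2 - F2 (hs k) (hs k)
          - 2 * expansion_remainder F x F1 F2 (t k) (hs k)) \<le> second_diff_quot G x (- F1) (t k) (hs k)"
        using growth_iff_second_diff_quot[OF G x True t_pos] by blast
      moreover have "2 * expansion_remainder F x F1 F2 (t k) (hs k) \<le> e"
        using elim True by auto
      ultimately show ?thesis
        by (elim order_trans[rotated]) simp
    next
      case False
      then show ?thesis
        using second_diff_quot_outside[OF G x t_pos] by simp
    qed
  qed
qed

text \<open>Upper semicontinuity is asked only along the given sequence, so that the bound serves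
  both alternatives: all weak-star convergent sequences in (a), a norm convergent one in
  (b).\<close>

lemma quadratic_growth_imp_liminf_second_diff_quot_ge:
  fixes G :: "'y::banach dual \<Rightarrow> ereal"
  assumes G: "\<And>x. G x \<noteq> -\<infinity>" and x: "x \<in> eff_dom G"
    and exp: "second_order_expansion G F x F1 F2"
    and growth: "quadratic_growth (objective F G) x c \<epsilon>" and "0 < \<epsilon>" "0 < c"
    and t: "pos_null_seq t" and hs: "weak_star_tendsto hs h" and "h \<noteq> 0"
    and usc: "limsup (\<lambda>k. ereal (F2 (hs k) (hs k))) \<le> ereal (F2 h h)"
  shows "ereal (c * (norm h)\<^sup>2 / 8 - F2 h h)
           \<le> liminf (\<lambda>k. second_diff_quot G x (- F1) (t k) (hs k))"
proof (rule Liminf_bounded)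
  \<comment> \<open>Eventually \<open>norm (hs k) > norm h / 2\<close>, which contributes
    \<open>4 * e\<close>. The upper limit of \<open>F2\<close> and the remainder cost
    \<open>e\<close> each, leaving \<open>2 * e = c * (norm h)^2 / 8\<close>.\<close>
  define e where "e = c * (norm h)\<^sup>2 / 16"
  have e: "0 < e"
    using \<open>0 < c\<close> \<open>h \<noteq> 0\<close> by (simp add: e_def)
  have "limsup (\<lambda>k. ereal (F2 (hs k) (hs k))) < ereal (F2 h h + e)"
    using usc e by (simp add: order.strict_trans1)
  then have "\<forall>\<^sub>F k in sequentially. ereal (F2 (hs k) (hs k)) < ereal (F2 h h + e)"
    by (rule Limsup_lessD)
  moreover have "\<forall>\<^sub>F k in sequentially. norm h / 2 < norm (hs k)"
    using \<open>h \<noteq> 0\<close> by (intro weak_star_norm_lsc[OF hs]) simp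
  moreover note quadratic_growth_imp_second_diff_quot_ge[OF G x exp growth \<open>0 < \<epsilon>\<close> t hs e]
  ultimately show "\<forall>\<^sub>F k in sequentially. ereal (c * (norm h)\<^sup>2 / 8 - F2 h h)
      \<le> second_diff_quot G x (- F1) (t k) (hs k)"
  proof eventually_elim
    case (elim k)
    have "(norm h / 2)\<^sup>2 \<le> (norm (hs k))\<^sup>2"
      using elim by (intro power_mono) auto
    then have "c * (norm h / 2)\<^sup>2 \<le> c * (norm (hs k))\<^sup>2"
      using \<open>0 < c\<close> by simp
    then have "c * (norm h)\<^sup>2 / 8 - F2 h h \<le> c * (norm (hs k))\<^sup>2 - F2 (hs k) (hs k) - e"
      using elim by (simp add: e_def power_divide)
    then show ?case
      using elim by (meson ereal_less_eq(3) order_trans)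
  qed
qed

section \<open>Necessity of the second-order conditions\<close>

text \<open>For unit directions the growth term is the constant \<open>c\<close>. Giving up
  \<open>c / 2\<close> for the remainder and halving leaves \<open>c / 4\<close>, while the
  \<open>F2\<close> terms cancel.\<close>

lemma quadratic_growth_imp_NDC:
  fixes G :: "'y::banach dual \<Rightarrow> ereal"
  assumes G: "\<And>x. G x \<noteq> -\<infinity>" and x: "x \<in> eff_dom G"
    and exp: "second_order_expansion G F x F1 F2"
    and growth: "quadratic_growth (objective F G) x c \<epsilon>" and "0 < \<epsilon>" "0 < c"
  shows "NDC G x F1 F2"
  unfolding NDC_def
proof (intro allI impI, elim conjE)
  fix t and hs :: "nat \<Rightarrow> 'y dual"
  assume t: "pos_null_seq t" and hs: "weak_star_tendsto hs 0" and unit: "\<forall>k. norm (hs k) = 1"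
  have "\<forall>\<^sub>F k in sequentially. ereal (c * (norm (hs k))\<^sup>2 - F2 (hs k) (hs k) - c / 2)
      \<le> second_diff_quot G x (- F1) (t k) (hs k)"
    using \<open>0 < c\<close>
    by (intro quadratic_growth_imp_second_diff_quot_ge[OF G x exp growth \<open>0 < \<epsilon>\<close> t hs]) simp
  then have "\<forall>\<^sub>F k in sequentially. ereal (c / 4) \<le>
      ereal (1 / (t k)\<^sup>2) * (G (x + t k *\<^sub>R hs k) - G x)
        + ereal (blinfun_apply (hs k /\<^sub>R t k) F1) + ereal (1 / 2 * F2 (hs k) (hs k))"
  proof eventually_elim
    case (elim k)
    have "0 < t k"
      using t by (simp add: pos_null_seq_def)
    have "ereal (c / 2 - F2 (hs k) (hs k)) \<le> second_diff_quot G x (- F1) (t k) (hs k)"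
      using elim unit by (simp add: field_simps)
    then have "ereal (c / 4) \<le>
        ereal (1 / 2) * (second_diff_quot G x (- F1) (t k) (hs k) + ereal (F2 (hs k) (hs k)))"
      by (cases "second_diff_quot G x (- F1) (t k) (hs k)") (auto simp: field_simps)
    then show ?case
      unfolding NDC_quotient_eq[OF G x G \<open>0 < t k\<close>] .
  qed
  then have "ereal (c / 4) \<le> liminf (\<lambda>k. ereal (1 / (t k)\<^sup>2) * (G (x + t k *\<^sub>R hs k) - G x)
        + ereal (blinfun_apply (hs k /\<^sub>R t k) F1) + ereal (1 / 2 * F2 (hs k) (hs k)))"
    by (rule Liminf_bounded)
  then show "0 < liminf (\<lambda>k. ereal (1 / (t k)\<^sup>2) * (G (x + t k *\<^sub>R hs k) - G x)
        + ereal (blinfun_apply (hs k /\<^sub>R t k) F1) + ereal (1 / 2 * F2 (hs k) (hs k)))"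
    using \<open>0 < c\<close> by (elim order.strict_trans2[rotated]) simp
qed

text \<open>Under (a) every sequence competing in the infimum obeys the lower bound. Under (b) a
  single recovery sequence attains the subderivative as a limit, and \<open>F2\<close> is continuous
  along it because it converges in norm.\<close>

lemma quadratic_growth_imp_second_subderiv_pos:
  fixes G :: "'y::banach dual \<Rightarrow> ereal"
  assumes G: "\<And>x. G x \<noteq> -\<infinity>" and x: "x \<in> eff_dom G"
    and F2: "bounded_bilinear F2"
    and exp: "second_order_expansion G F x F1 F2"
    and growth: "quadratic_growth (objective F G) x c \<epsilon>" and "0 < \<epsilon>" "0 < c"
    and regular: "seq_weak_star_usc (\<lambda>h. F2 h h) \<or> strongly_twice_epi_diff G x (- F1)"
    and "h \<noteq> 0"
  shows "0 < ereal (F2 h h) + weak_star_second_subderiv G x (- F1) h"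
proof -
  note liminf_ge = quadratic_growth_imp_liminf_second_diff_quot_ge
    [OF G x exp growth \<open>0 < \<epsilon>\<close> \<open>0 < c\<close> _ _ \<open>h \<noteq> 0\<close>]
  have "ereal (c * (norm h)\<^sup>2 / 8 - F2 h h) \<le> weak_star_second_subderiv G x (- F1) h"
    using regular
  proof
    assume "seq_weak_star_usc (\<lambda>h. F2 h h)"
    then show ?thesis
      unfolding weak_star_second_subderiv_def
      by (intro Inf_greatest) (auto simp: seq_weak_star_usc_def intro!: liminf_ge)
  next
    assume epi: "strongly_twice_epi_diff G x (- F1)"
    \<comment> \<open>One arbitrary null sequence suffices, since epi-differentiability provides
      recovery directions for each.\<close>
    define t :: "nat \<Rightarrow> real" where "t k = inverse (real (Suc k))" for k
    have t: "pos_null_seq t"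
      unfolding pos_null_seq_def t_def using LIMSEQ_inverse_real_of_nat by simp
    obtain hs where hs: "hs \<longlonglongrightarrow> h"
      and quot: "(\<lambda>k. second_diff_quot G x (- F1) (t k) (hs k))
          \<longlonglongrightarrow> weak_star_second_subderiv G x (- F1) h"
      using epi t unfolding strongly_twice_epi_diff_def by blast
    have "(\<lambda>k. ereal (F2 (hs k) (hs k))) \<longlonglongrightarrow> ereal (F2 h h)"
      by (intro tendsto_ereal bounded_bilinear.tendsto[OF F2] hs)
    then have "limsup (\<lambda>k. ereal (F2 (hs k) (hs k))) \<le> ereal (F2 h h)"
      using lim_imp_Limsup[OF trivial_limit_sequentially] by (metis order_refl)
    then have "ereal (c * (norm h)\<^sup>2 / 8 - F2 h h)
        \<le> liminf (\<lambda>k. second_diff_quot G x (- F1) (t k) (hs k))"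
      by (rule liminf_ge[OF t tendsto_imp_weak_star_tendsto[OF hs]])
    then show ?thesis
      using lim_imp_Liminf[OF _ quot] by simp
  qed
  moreover have "0 < c * (norm h)\<^sup>2"
    using \<open>0 < c\<close> \<open>h \<noteq> 0\<close> by simp
  \<comment> \<open>The subderivative may be \<open>\<infinity>\<close>; the lower bound excludes
    \<open>-\<infinity>\<close>.\<close>
  ultimately show ?thesis
    by (cases "weak_star_second_subderiv G x (- F1) h") auto
qed

section \<open>Sufficiency of the second-order conditions\<close>

lemma not_quadratic_growth_obtain_seq:
  fixes G :: "'y::real_normed_vector dual \<Rightarrow> ereal"
  assumes sep: "separable_space (euclidean :: 'y topology)"
    and G: "\<And>x. G x \<noteq> -\<infinity>" and x: "x \<in> eff_dom G"
    and exp: "second_order_expansion G F x F1 F2"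
    and no_growth: "\<not> (\<exists>c>0. \<exists>\<epsilon>>0. quadratic_growth (objective F G) x c \<epsilon>)"
  obtains t hs h where "pos_null_seq t" "weak_star_tendsto hs h" "\<forall>k. norm (hs k) = 1"
    "\<forall>e>0. \<forall>\<^sub>F k in sequentially.
       second_diff_quot G x (- F1) (t k) (hs k) < ereal (e - F2 (hs k) (hs k))"
proof -
  \<comment> \<open>The same number serves as growth constant and as radius in the negated growth
    condition.\<close>
  define \<delta> :: "nat \<Rightarrow> real" where "\<delta> n = inverse (real (Suc n))" for n
  have \<delta>: "0 < \<delta> n" for n
    by (simp add: \<delta>_def)
  have "\<forall>n. \<exists>y. norm (y - x) \<le> \<delta> n \<and>
      \<not> objective F G x + ereal (\<delta> n / 2 * (norm (y - x))\<^sup>2) \<le> objective F G y"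
    using no_growth \<delta> unfolding quadratic_growth_def by blast
  then obtain y where y: "\<And>n. norm (y n - x) \<le> \<delta> n"
    "\<And>n. \<not> objective F G x + ereal (\<delta> n / 2 * (norm (y n - x))\<^sup>2) \<le> objective F G (y n)"
    by metis
  define t where "t n = norm (y n - x)" for n
  define hs where "hs n = sgn (y n - x)" for n
  have y_eq: "y n = x + t n *\<^sub>R hs n" for n
    by (cases "y n = x") (simp_all add: t_def hs_def sgn_div_norm)
  \<comment> \<open>At \<open>x\<close> itself the growth inequality is trivial, so it cannot be
    violated there.\<close>
  have "y n \<noteq> x" for n
    using y(2)[of n] by auto
  then have t_pos: "0 < t n" and unit: "norm (hs n) = 1" for n
    by (auto simp: t_def hs_def norm_sgn)
  \<comment> \<open>Outside the domain the objective is infinite, so growth cannot fail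
    there.\<close>
  have y_dom: "x + t n *\<^sub>R hs n \<in> eff_dom G" for n
    using y(2)[of n] unfolding y_eq[symmetric] by (auto simp: objective_def split: if_splits)
  have \<delta>_lim: "\<delta> \<longlonglongrightarrow> 0"
    unfolding \<delta>_def by (rule LIMSEQ_inverse_real_of_nat)
  have "t \<longlonglongrightarrow> 0"
    by (rule tendsto_sandwich[OF _ _ tendsto_const \<delta>_lim]) (use y t_pos in \<open>auto simp: t_def\<close>)
  then have t: "pos_null_seq t"
    using t_pos by (simp add: pos_null_seq_def)
  have quot: "second_diff_quot G x (- F1) (t n) (hs n) <
      ereal (\<delta> n - F2 (hs n) (hs n) - 2 * expansion_remainder F x F1 F2 (t n) (hs n))" for n
    using y(2)[of n] growth_iff_second_diff_quot[where G = G and a = "\<delta> n" and F = F and ?F1.0 = F1 and ?F2.0 = F2, OF G x y_dom t_pos]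
    unfolding t_def[symmetric] y_eq[symmetric] not_le[symmetric] by blast
  obtain r h where r: "strict_mono (r :: nat \<Rightarrow> nat)" and hs: "weak_star_tendsto (hs \<circ> r) h"
    using separable_bounded_weak_star_convergent_subseq[OF sep, of hs 1] unit by auto
  note tr = pos_null_seq_subseq[OF t r]
  have "\<forall>\<^sub>F k in sequentially.
      second_diff_quot G x (- F1) ((t \<circ> r) k) ((hs \<circ> r) k) < ereal (e - F2 ((hs \<circ> r) k) ((hs \<circ> r) k))"
    if "0 < e" for e
  proof -
    have "\<forall>\<^sub>F k in sequentially. x + (t \<circ> r) k *\<^sub>R (hs \<circ> r) k \<in> eff_dom G \<longrightarrow>
        \<bar>expansion_remainder F x F1 F2 ((t \<circ> r) k) ((hs \<circ> r) k)\<bar> < e / 4"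
      using that by (intro eventually_expansion_remainder_small[OF exp tr hs]) simp
    moreover have "\<forall>\<^sub>F k in sequentially. (\<delta> \<circ> r) k < e / 2"
      using order_tendstoD(2)[OF LIMSEQ_subseq_LIMSEQ[OF \<delta>_lim r], of "e / 2"] that by simp
    ultimately show ?thesis
    proof eventually_elim
      case (elim k)
      have "\<bar>expansion_remainder F x F1 F2 (t (r k)) (hs (r k))\<bar> < e / 4"
        using elim y_dom by simp
      \<comment> \<open>Twice \<open>e / 4\<close> from the remainder and \<open>e / 2\<close> from
        \<open>\<delta>\<close> add up to \<open>e\<close>.\<close>
      then have "\<delta> (r k) - F2 (hs (r k)) (hs (r k)) - 2 * expansion_remainder F x F1 F2 (t (r k)) (hs (r k))
          \<le> e - F2 (hs (r k)) (hs (r k))"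
        using elim by simp
      then show ?case
        using quot[of "r k"] by (simp add: order.strict_trans2)
    qed
  qed
  then show ?thesis
    using that[OF tr hs] unit by simp
qed

lemma second_order_conditions_imp_quadratic_growth:
  fixes G :: "'y::real_normed_vector dual \<Rightarrow> ereal"
  assumes sep: "separable_space (euclidean :: 'y topology)"
    and G: "\<And>x. G x \<noteq> -\<infinity>" and x: "x \<in> eff_dom G"
    and exp: "second_order_expansion G F x F1 F2"
    and lsc: "seq_weak_star_lsc (\<lambda>h. F2 h h)"
    and pos: "\<And>h. h \<noteq> 0 \<Longrightarrow> 0 < ereal (F2 h h) + weak_star_second_subderiv G x (- F1) h"
    and ndc: "NDC G x F1 F2"
  shows "\<exists>c>0. \<exists>\<epsilon>>0. quadratic_growth (objective F G) x c \<epsilon>"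
proof (rule ccontr)
  assume no_growth: "\<not> ?thesis"
  obtain t hs h where t: "pos_null_seq t" and hs: "weak_star_tendsto hs h"
    and unit: "\<forall>k. norm (hs k) = 1"
    and quot: "\<forall>e>0. \<forall>\<^sub>F k in sequentially.
       second_diff_quot G x (- F1) (t k) (hs k) < ereal (e - F2 (hs k) (hs k))"
    by (rule not_quadratic_growth_obtain_seq[OF sep G x exp no_growth])
  show False
  proof (cases "h = 0")
    case True
    \<comment> \<open>Zero limit: the violating sequence is admissible in (NDC), and
      \<open>quot\<close> makes its lower limit at most zero.\<close>
    let ?q = "\<lambda>k. ereal (1 / (t k)\<^sup>2) * (G (x + t k *\<^sub>R hs k) - G x)
        + ereal (blinfun_apply (hs k /\<^sub>R t k) F1) + ereal (1 / 2 * F2 (hs k) (hs k))"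
    have "0 < liminf ?q"
      using ndc t hs unit True unfolding NDC_def by blast
    moreover have "liminf ?q \<le> 0"
    proof (rule ereal_le_epsilon2)
      fix e :: real
      assume "0 < e"
      have "\<forall>\<^sub>F k in sequentially. ?q k \<le> ereal e"
        using quot[rule_format, OF \<open>0 < e\<close>]
      proof eventually_elim
        case (elim k)
        have "0 < t k"
          using t by (simp add: pos_null_seq_def)
        have "ereal (1 / 2) * (second_diff_quot G x (- F1) (t k) (hs k) + ereal (F2 (hs k) (hs k)))
            \<le> ereal e"
          using elim \<open>0 < e\<close> by (cases "second_diff_quot G x (- F1) (t k) (hs k)") auto
        then show ?case
          unfolding NDC_quotient_eq[OF G x G \<open>0 < t k\<close>] .
      qed
      then show "liminf ?q \<le> 0 + ereal e"
        by (simp add: Liminf_le)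
    qed
    ultimately show False
      by simp
  next
    case False
    \<comment> \<open>Nonzero limit: lower semicontinuity replaces \<open>F2 (hs k) (hs k)\<close>
      by \<open>F2 h h\<close>. The sequence competes in the infimum, so the subderivative is at
      most \<open>- F2 h h\<close>, against positivity.\<close>
    have "liminf (\<lambda>k. second_diff_quot G x (- F1) (t k) (hs k)) \<le> ereal (- F2 h h)"
    proof (rule ereal_le_epsilon2)
      fix e :: real
      assume "0 < e"
      have "ereal (F2 h h - e / 2) < ereal (F2 h h)"
        using \<open>0 < e\<close> by simp
      also have "\<dots> \<le> liminf (\<lambda>k. ereal (F2 (hs k) (hs k)))"
        using lsc hs unfolding seq_weak_star_lsc_def by blast
      finally have "\<forall>\<^sub>F k in sequentially. ereal (F2 h h - e / 2) < ereal (F2 (hs k) (hs k))"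
        by (rule less_LiminfD)
      moreover have "\<forall>\<^sub>F k in sequentially.
          second_diff_quot G x (- F1) (t k) (hs k) < ereal (e / 2 - F2 (hs k) (hs k))"
        using \<open>0 < e\<close> by (intro quot[rule_format]) simp
      ultimately have "\<forall>\<^sub>F k in sequentially.
          second_diff_quot G x (- F1) (t k) (hs k) \<le> ereal (- F2 h h) + ereal e"
      proof eventually_elim
        case (elim k)
        then show ?case
          by (cases "second_diff_quot G x (- F1) (t k) (hs k)") auto
      qed
      then show "liminf (\<lambda>k. second_diff_quot G x (- F1) (t k) (hs k)) \<le> ereal (- F2 h h) + ereal e"
        by (simp add: Liminf_le)
    qed
    moreover have "weak_star_second_subderiv G x (- F1) h
        \<le> liminf (\<lambda>k. second_diff_quot G x (- F1) (t k) (hs k))"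
      unfolding weak_star_second_subderiv_def using t hs by (intro Inf_lower) blast
    ultimately have "weak_star_second_subderiv G x (- F1) h \<le> ereal (- F2 h h)"
      by (rule order_trans[rotated])
    then show False
      using pos[OF False] by (cases "weak_star_second_subderiv G x (- F1) h") auto
  qed
qed

theorem theorem2p20:
  fixes G :: "'y::banach dual \<Rightarrow> ereal"
    and F :: "'y dual \<Rightarrow> real"
    and x0 :: "'y dual"
    and F1 :: 'y
    and F2 :: "'y dual \<Rightarrow> 'y dual \<Rightarrow> real"
  assumes "separable_space (euclidean :: 'y topology)"
    and "\<And>x. G x \<noteq> -\<infinity>"
    and "x0 \<in> eff_dom G"
    and "bounded_bilinear F2"
    and "second_order_expansion G F x0 F1 F2"
    and "seq_weak_star_lsc (\<lambda>h. F2 h h)"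
    and "seq_weak_star_usc (\<lambda>h. F2 h h) \<or> strongly_twice_epi_diff G x0 (- F1)"
  shows "(\<forall>h. h \<noteq> 0 \<longrightarrow> ereal (F2 h h) + weak_star_second_subderiv G x0 (- F1) h > 0)
           \<and> NDC G x0 F1 F2
         \<longleftrightarrow> (\<exists>c>0. \<exists>\<epsilon>>0. quadratic_growth (objective F G) x0 c \<epsilon>)"
  using second_order_conditions_imp_quadratic_growth[OF assms(1-3,5,6)]
    quadratic_growth_imp_NDC[OF assms(2,3,5)]
    quadratic_growth_imp_second_subderiv_pos[OF assms(2-5) _ _ _ assms(7)]
  by blast

end
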